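(* Let $f\colon\mathbb{R}^n\to\mathbb{R}^n$ be a tropical algebraic rational map with linear pieces $(f_i,C_i)$, $i=1,\dots,N$, and let $J_i$ denote the determinant of the Jacobian matrix of $f_i$. Then $f$ is an isomorphism if and only if both of the following hold: (1) all the $J_i$, $1\le i\le N$, have the same sign (i.e. either all $J_i>0$ or all $J_i<0$); (2) $|f^{-1}(y_0)|=1$ for at least one regular value $y_0\in\mathbb{R}^n$ of $f$.
   Context: Here "linear" means polynomial of degree at most one (constant terms are allowed). A tropical algebraic rational function on $\mathbb{R}^n$ is a function $\mathbb{R}^n\to\mathbb{R}$ of the form $\min\{A_1,\dots,A_k\}-\min\{B_1,\dots,B_l\}$, where $A_1,\dots,A_k,B_1,\dots,B_l$ are linear functions with rational coefficients. A tropical algebraic rational map $\mathbb{R}^n\to\mathbb{R}^m$ is a map each of whose coordinates is a tropical algebraic rational function. For such a map $f$ there is a finite decomposition $\mathbb{R}^n=\bigcup_{i=1}^N C_i$ into closed $n$-dimensional (convex) polyhedra with pairwise disjoint interiors, together with linear maps $f_i$ such that $f=f_i$ on $C_i$; the pairs $(f_i,C_i)$ (or just the $f_i$) are called the linear pieces of $f$. A point $y\in\mathbb{R}^n$ is called a regular value of $f$ if it does not belong to $\bigcup_{i=1}^N f(\partial C_i)$, where $\partial C_i$ is the topological boundary of $C_i$. A tropical algebraic rational map $\mathbb{R}^n\to\mathbb{R}^n$ is called an isomorphism if it is a bijection (its inverse is then also a tropical algebraic rational map). *)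

theory Defs
  imports "HOL-Analysis.Analysis"
begin

(* "Linear" means polynomial of degree at most one, so constant terms are allowed. *)

definition rational_linear_fun :: "(real ^ 'n \<Rightarrow> real) \<Rightarrow> bool" where
  "rational_linear_fun h \<longleftrightarrow>
     (\<exists>a c. (\<forall>i. a $ i \<in> \<rat>) \<and> c \<in> \<rat> \<and> h = (\<lambda>x. (\<Sum>i\<in>UNIV. a $ i * x $ i) + c))"

definition linear_map :: "(real ^ 'n \<Rightarrow> real ^ 'm) \<Rightarrow> bool" where
  "linear_map g \<longleftrightarrow> (\<exists>A b. g = (\<lambda>x. A *v x + b))"

definition tropical_rational_fun :: "(real ^ 'n \<Rightarrow> real) \<Rightarrow> bool" where
  "tropical_rational_fun h \<longleftrightarrow>
     (\<exists>\<A> \<B>. finite \<A> \<and> \<A> \<noteq> {} \<and> (\<forall>a\<in>\<A>. rational_linear_fun a) \<and>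
            finite \<B> \<and> \<B> \<noteq> {} \<and> (\<forall>b\<in>\<B>. rational_linear_fun b) \<and>
            h = (\<lambda>x. Min ((\<lambda>a. a x) ` \<A>) - Min ((\<lambda>b. b x) ` \<B>)))"

definition tropical_rational_map :: "(real ^ 'n \<Rightarrow> real ^ 'm) \<Rightarrow> bool" where
  "tropical_rational_map f \<longleftrightarrow> (\<forall>j. tropical_rational_fun (\<lambda>x. f x $ j))"

definition tropical_isomorphism :: "(real ^ 'n \<Rightarrow> real ^ 'n) \<Rightarrow> bool" where
  "tropical_isomorphism f \<longleftrightarrow> tropical_rational_map f \<and> bij f"

(* The linear maps of the pieces need not be assumed to have rational coefficients:
   on a full-dimensional cell this is forced when f is a tropical rational map.
   A polyhedron is a finite intersection of closed half-spaces, hence closed and convex. *)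

definition linear_pieces ::
    "(real ^ 'n \<Rightarrow> real ^ 'm) \<Rightarrow> nat \<Rightarrow> (nat \<Rightarrow> real ^ 'n \<Rightarrow> real ^ 'm) \<Rightarrow> (nat \<Rightarrow> (real ^ 'n) set) \<Rightarrow> bool"
  where
  "linear_pieces f N g C \<longleftrightarrow>
     (\<Union>i\<in>{1..N}. C i) = UNIV \<and>
     (\<forall>i\<in>{1..N}. polyhedron (C i) \<and> aff_dim (C i) = int CARD('n)) \<and>
     (\<forall>i\<in>{1..N}. \<forall>j\<in>{1..N}. i \<noteq> j \<longrightarrow> interior (C i) \<inter> interior (C j) = {}) \<and>
     (\<forall>i\<in>{1..N}. linear_map (g i) \<and> (\<forall>x\<in>C i. f x = g i x))"

definition regular_value ::
    "(real ^ 'n \<Rightarrow> real ^ 'n) \<Rightarrow> nat \<Rightarrow> (nat \<Rightarrow> (real ^ 'n) set) \<Rightarrow> real ^ 'n \<Rightarrow> bool" where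
  "regular_value f N C y \<longleftrightarrow> y \<notin> (\<Union>i\<in>{1..N}. f ` frontier (C i))"

end

theory Submission
  imports Defs
begin

text \<open>
  The walls are the hyperplanes bounding the cells. Away from the set of codimension at least two
  where two distinct walls meet, \<open>f\<close> is locally a map with two affine pieces on the two sides of a
  hyperplane. Their linear parts differ by a matrix of rank one, and by the determinant formula for
  such a change the fold is locally injective if the determinants have the same sign, and not
  injective if the signs are opposite.

  The complement of finitely many affine subspaces of codimension at least two is connected. In the
  domain this forces all determinants of an injective \<open>f\<close> to have the same sign. In the target, let
  \<open>Y\<close> be the complement of the images of the intersections of walls. If the determinants have
  the same sign then \<open>f\<close> is locally injective, hence open by invariance of domain, at every point
  over \<open>Y\<close>, so that the values in \<open>Y\<close> attained at least twice form a relatively clopen subset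
  of \<open>Y\<close>; a regular value with one preimage makes it empty. The same argument, applied to small
  balls around two points with the same image, yields doubly attained values in \<open>Y\<close>. This replaces
  the degree of \<open>f\<close>.
\<close>

section \<open>Two affine maps agreeing on a hyperplane\<close>

text \<open>In an orthonormal basis whose \<open>k\<close>-th vector is \<open>a / norm a\<close>,
  the two matrices differ only in column \<open>k\<close>, and Cramer's rule evaluates the effect of
  replacing that column.\<close>

lemma det_rank_one_change:
  fixes A A' :: "real ^ 'n ^ 'n"
  assumes a: "a \<noteq> 0" and agree: "\<And>u. a \<bullet> u = 0 \<Longrightarrow> A' *v u = A *v u"
    and p: "A *v p = A' *v a"
  shows "det A' * (a \<bullet> a) = det A * (a \<bullet> p)"
proof -
  \<comment> \<open>Any index serves; \<open>undefined\<close> merely names one.\<close>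
  define k where "k = (undefined :: 'n)"
  have "norm (axis k 1 :: real^'n) = 1" "norm (a /\<^sub>R norm a) = 1"
    using a by simp_all
  then obtain h :: "real^'n \<Rightarrow> real^'n" where h: "orthogonal_transformation h" and hk: "h (axis k 1) = a /\<^sub>R norm a"
    by (rule orthogonal_transformation_exists_1)
  define M where "M = matrix h"
  have M: "M *v u = h u" for u
    using h unfolding M_def by (simp add: orthogonal_transformation_def matrix_works)
  have "orthogonal_matrix M"
    using h unfolding M_def by (simp add: orthogonal_transformation_matrix)
  then have detM: "det M \<noteq> 0"
    using det_orthogonal_matrix[of M] by auto
  have dot: "h u \<bullet> h v = u \<bullet> v" for u v
    using h by (simp add: orthogonal_transformation_def)
  obtain x where x: "h x = p /\<^sub>R norm a"
    using orthogonal_transformation_surj[OF h] by (metis surjD)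
  have "x $ k = h (axis k 1) \<bullet> h x"
    by (simp add: dot inner_axis' )
  then have xk: "x $ k = (a \<bullet> p) / (a \<bullet> a)"
    by (simp add: hk x power2_norm_eq_inner[symmetric] power2_eq_square field_simps)
  have col: "(A' ** M) $ i $ j = (if j = k then ((A ** M) *v x) $ i else (A ** M) $ i $ j)" for i j
  proof (cases "j = k")
    case True
    have "(A' ** M) *v axis k 1 = (A ** M) *v x"
      by (simp add: matrix_vector_mul_assoc[symmetric] M hk x matrix_vector_mult_scaleR p)
    then show ?thesis
      using True by (simp add: matrix_vector_mult_basis column_def vec_eq_iff)
  next
    case False
    have "a \<bullet> h (axis j 1) = norm a *\<^sub>R (h (axis k 1) \<bullet> h (axis j 1))"
      using a by (simp add: hk)
    also have "\<dots> = 0"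
      using False by (simp add: dot inner_axis_axis)
    finally have "(A' ** M) *v axis j 1 = (A ** M) *v axis j 1"
      by (simp add: matrix_vector_mul_assoc[symmetric] M agree)
    then show ?thesis
      using False by (simp add: matrix_vector_mult_basis column_def vec_eq_iff)
  qed
  have "det (A' ** M) = x $ k * det (A ** M)"
    unfolding cramer_lemma[symmetric]
    by (rule arg_cong[of _ _ det]) (simp add: vec_eq_iff col)
  then show ?thesis
    using detM a by (simp add: det_mul xk field_simps)
qed

text \<open>Splitting \<open>u\<close> along \<open>a\<close> and its orthogonal hyperplane exhibits
  \<open>A'\<close> as \<open>A\<close> composed with the map that fixes the hyperplane and sends
  \<open>a\<close> to \<open>p\<close>.\<close>

lemma affine_agree_decompose:
  fixes A A' :: "real ^ 'n ^ 'n"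
  assumes a: "a \<noteq> 0" and agree: "\<And>u. a \<bullet> u = 0 \<Longrightarrow> A' *v u = A *v u"
    and p: "A *v p = A' *v a"
  shows "A' *v u = A *v (u + ((a \<bullet> u) / (a \<bullet> a)) *\<^sub>R (p - a))"
proof -
  define c where "c = (a \<bullet> u) / (a \<bullet> a)"
  have "a \<bullet> (u - c *\<^sub>R a) = 0"
    using a by (simp add: c_def inner_diff_right)
  from agree[OF this] have "A' *v u - c *\<^sub>R (A' *v a) = A *v u - c *\<^sub>R (A *v a)"
    by (simp add: matrix_vector_mult_diff_distrib matrix_vector_mult_scaleR)
  then show ?thesis
    unfolding c_def[symmetric] p[symmetric]
    by (simp add: matrix_vector_mult_diff_distrib matrix_vector_mult_scaleR
        matrix_vector_mult_add_rdistrib matrix_vector_right_distrib algebra_simps)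
qed

lemma det_nonzero_solve:
  fixes A :: "real ^ 'n ^ 'n"
  assumes "det A \<noteq> 0"
  obtains p where "A *v p = y"
  using assms by (metis invertible_det_nz invertible_def matrix_vector_mul_assoc matrix_vector_mul_lid)

lemma det_nonzero_inj:
  fixes A :: "real ^ 'n ^ 'n"
  assumes "det A \<noteq> 0"
  shows "A *v u = A *v v \<longleftrightarrow> u = v"
  using assms by (metis invertible_det_nz invertible_def matrix_vector_mul_assoc matrix_vector_mul_lid)

text \<open>The map fixing the hyperplane and sending \<open>a\<close> to \<open>p\<close> scales
  the \<open>a\<close>-coordinate by \<open>(a \<bullet> p) / (a \<bullet> a)\<close>, the ratio of
  the determinants. A positive ratio preserves each side, so a coincidence of values can only occur
  on the hyperplane.\<close>

lemma coherent_fold_injective: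
  fixes A A' :: "real ^ 'n ^ 'n"
  assumes a: "a \<noteq> 0" and agree: "\<And>u. a \<bullet> u = 0 \<Longrightarrow> A' *v u = A *v u"
    and det: "det A * det A' > 0"
    and u: "a \<bullet> u \<ge> 0" and u': "a \<bullet> u' \<le> 0" and eq: "A *v u = A' *v u'"
  shows "u = u'"
proof -
  have nz: "det A \<noteq> 0" using det by auto
  then obtain p where p: "A *v p = A' *v a" by (rule det_nonzero_solve)
  have "det A' * (a \<bullet> a) = det A * (a \<bullet> p)"
    by (rule det_rank_one_change[OF a agree p])
  then have "(det A * det A') * (a \<bullet> a) = (det A)\<^sup>2 * (a \<bullet> p)"
    by (simp add: power2_eq_square)
  moreover have "(det A * det A') * (a \<bullet> a) > 0"
    using det a by simp
  ultimately have pos: "a \<bullet> p > 0"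
    using nz by (simp add: zero_less_mult_iff)
  have u_eq: "u = u' + ((a \<bullet> u') / (a \<bullet> a)) *\<^sub>R (p - a)"
    using eq affine_agree_decompose[OF a agree p, of u'] det_nonzero_inj[OF nz] by metis
  then have "a \<bullet> u = a \<bullet> u' + ((a \<bullet> u') / (a \<bullet> a)) * (a \<bullet> p - a \<bullet> a)"
    by (metis inner_add_right inner_diff_right inner_scaleR_right)
  then have "a \<bullet> u = (a \<bullet> u') * ((a \<bullet> p) / (a \<bullet> a))"
    using a by (simp add: field_simps)
  moreover have "(a \<bullet> p) / (a \<bullet> a) > 0" using pos a by simp
  ultimately have "a \<bullet> u' = 0"
    using u u' by (metis antisym mult_le_cancel_right_pos mult_zero_left)
  then show ?thesis using u_eq by simp
qed

text \<open>The scaling factor is now negative, so \<open>p\<close> and \<open>a\<close> lie on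
  opposite sides although \<open>A p = A' a\<close>. Negative multiples put each of them on the side
  where its own matrix is in force.\<close>

lemma incoherent_fold_not_injective:
  fixes A A' :: "real ^ 'n ^ 'n"
  assumes a: "a \<noteq> 0" and agree: "\<And>u. a \<bullet> u = 0 \<Longrightarrow> A' *v u = A *v u"
    and det: "det A * det A' < 0"
  obtains p where "a \<bullet> p < 0" and "\<And>t. A *v (- t *\<^sub>R p) = A' *v (- t *\<^sub>R a)"
proof -
  have nz: "det A \<noteq> 0" using det by auto
  then obtain p where p: "A *v p = A' *v a" by (rule det_nonzero_solve)
  have "det A' * (a \<bullet> a) = det A * (a \<bullet> p)"
    by (rule det_rank_one_change[OF a agree p])
  then have "(det A * det A') * (a \<bullet> a) = (det A)\<^sup>2 * (a \<bullet> p)"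
    by (simp add: power2_eq_square)
  moreover have "(det A * det A') * (a \<bullet> a) < 0"
    using det a by (simp add: mult_neg_pos)
  ultimately have "a \<bullet> p < 0"
    using nz by (simp add: mult_less_0_iff)
  moreover have "A *v (- t *\<^sub>R p) = A' *v (- t *\<^sub>R a)" for t
    by (simp add: matrix_vector_mult_scaleR p del: scaleR_minus_left)
  ultimately show ?thesis by (rule that)
qed

section \<open>Complements of sets of codimension two\<close>

lemma negligible_low_aff_dim:
  fixes T :: "'a::euclidean_space set"
  assumes "aff_dim T < DIM('a)"
  shows "negligible T"
proof -
  obtain a b where "a \<noteq> 0" "affine hull T \<subseteq> {x. a \<bullet> x = b}"
    using aff_lowdim_subset_hyperplane[OF assms] by (metis hull_minimal affine_hyperplane)
  then show ?thesis
    by (metis hull_subset negligible_hyperplane negligible_subset order_trans)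
qed

lemma open_meets_complement_negligible:
  fixes U :: "'a::euclidean_space set"
  assumes "open U" "U \<noteq> {}" "negligible T"
  obtains x where "x \<in> U" "x \<notin> T"
  using assms open_not_negligible negligible_subset by blast

lemma codim2_hyperplane_Int:
  fixes a a' :: "'a::euclidean_space"
  assumes "a \<noteq> 0" "a' \<noteq> 0" and "{x. a \<bullet> x = b} \<noteq> {x. a' \<bullet> x = b'}"
  shows "aff_dim ({x. a \<bullet> x = b} \<inter> {x. a' \<bullet> x = b'}) \<le> int DIM('a) - 2"
proof -
  have "\<not> {x. a \<bullet> x = b} \<subseteq> {x. a' \<bullet> x = b'}"
  proof
    assume sub: "{x. a \<bullet> x = b} \<subseteq> {x. a' \<bullet> x = b'}"
    have "(b / (a \<bullet> a)) *\<^sub>R a \<in> {x. a \<bullet> x = b}"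
      using assms(1) by simp
    then have "{x. a \<bullet> x = b} \<noteq> {}" by blast
    then show False
      using affine_dim_equal[OF affine_hyperplane affine_hyperplane _ sub] assms
      by simp
  qed
  then show ?thesis
    using aff_dim_affine_Int_hyperplane[OF affine_hyperplane, of a b a' b'] assms(1)
    by (auto simp: aff_dim_hyperplane Suc_le_eq)
qed

text \<open>Parallel walls intersect in the empty set, whose affine dimension -1 respects the bound;
  in dimension one no other member is possible.\<close>

definition codim2_family :: "'a::euclidean_space set set \<Rightarrow> bool" where
  "codim2_family \<T> \<longleftrightarrow> finite \<T> \<and> (\<forall>T\<in>\<T>. affine T \<and> aff_dim T \<le> int DIM('a) - 2)"

lemma negligible_codim2:
  assumes "codim2_family \<T>"
  shows "negligible (\<Union>\<T>)"
proof (rule negligible_Union)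
  show "finite \<T>" using assms by (simp add: codim2_family_def)
  show "negligible T" if "T \<in> \<T>" for T
    using assms that by (intro negligible_low_aff_dim) (fastforce simp: codim2_family_def)
qed

text \<open>A generic segment misses the removed sets: together with its starting point, each of them
  spans at most a hyperplane.\<close>

lemma connected_convex_diff_codim2:
  fixes W :: "'a::euclidean_space set"
  assumes W: "open W" "convex W" and codim2: "codim2_family \<T>"
  shows "connected (W - \<Union>\<T>)"
  unfolding connected_iff_connected_component
proof (intro ballI)
  have fin: "finite \<T>" and aff: "\<And>T. T \<in> \<T> \<Longrightarrow> affine T"
    and dim: "\<And>T. T \<in> \<T> \<Longrightarrow> aff_dim T \<le> int DIM('a) - 2"
    using codim2 by (auto simp: codim2_family_def)
  fix x y assume x: "x \<in> W - \<Union>\<T>" and y: "y \<in> W - \<Union>\<T>"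
  have cl: "closed (\<Union>\<T>)"
    using fin aff by (auto intro: affine_closed)
  then have "open (W - \<Union>\<T>)"
    using W by (simp add: open_Diff)
  then obtain e where e: "e > 0" "ball y e \<subseteq> W - \<Union>\<T>"
    using y by (meson openE)
  \<comment> \<open>Adding \<open>x\<close> raises the dimension of \<open>T\<close> by at most one,
    so some \<open>z\<close> near \<open>y\<close> avoids all these hulls.\<close>
  have "negligible (\<Union>T\<in>\<T>. affine hull insert x T)"
  proof (rule negligible_Union)
    show "negligible B" if B: "B \<in> (\<lambda>T. affine hull insert x T) ` \<T>" for B
    proof -
      obtain T where T: "T \<in> \<T>" "B = affine hull insert x T" using B by auto
      have "aff_dim B \<le> aff_dim T + 1"
        by (simp add: T aff_dim_insert)
      with dim[OF T(1)] show ?thesis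
        by (intro negligible_low_aff_dim) simp
    qed
  qed (use fin in simp)
  then obtain z where z: "z \<in> ball y e" "z \<notin> (\<Union>T\<in>\<T>. affine hull insert x T)"
    using open_meets_complement_negligible[of "ball y e"] e by (metis centre_in_ball empty_iff open_ball)
  have "closed_segment x z \<inter> \<Union>\<T> = {}"
  proof (rule ccontr)
    assume "closed_segment x z \<inter> \<Union>\<T> \<noteq> {}"
    then obtain w T where w: "w \<in> closed_segment x z" "w \<in> T" "T \<in> \<T>" by auto
    then obtain t where t: "w = (1 - t) *\<^sub>R x + t *\<^sub>R z"
      by (auto simp: in_segment)
    \<comment> \<open>A hit \<open>w\<close> different from \<open>x\<close> would put
      \<open>z\<close> on the line through \<open>x\<close> and \<open>w\<close>, inside the hull
      that it avoids.\<close>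
    have "w \<noteq> x" using w x by auto
    then have "t \<noteq> 0" using t by auto
    then have "z = (1 - 1 / t) *\<^sub>R x + (1 / t) *\<^sub>R w"
      by (simp add: t algebra_simps)
    moreover have "x \<in> affine hull insert x T" "w \<in> affine hull insert x T"
      using w by (auto simp: hull_inc)
    then have "(1 - 1 / t) *\<^sub>R x + (1 / t) *\<^sub>R w \<in> affine hull insert x T"
      by (intro mem_affine) auto
    ultimately have "z \<in> affine hull insert x T" by simp
    then show False using z w by auto
  qed
  moreover have "closed_segment x z \<subseteq> W"
    using W x z e by (intro closed_segment_subset) auto
  ultimately have "connected_component (W - \<Union>\<T>) x z"
    unfolding connected_component_def
    by (intro exI[of _ "closed_segment x z"]) auto
  moreover have "connected_component (W - \<Union>\<T>) z y"
    unfolding connected_component_def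
    using e z by (intro exI[of _ "ball y e"]) auto
  ultimately show "connected_component (W - \<Union>\<T>) x y"
    by (rule connected_component_trans)
qed

section \<open>Locally injective maps outside codimension two\<close>

definition locally_inj_at :: "('a::metric_space \<Rightarrow> 'b) \<Rightarrow> 'a \<Rightarrow> bool" where
  "locally_inj_at f x \<longleftrightarrow> (\<exists>e>0. inj_on f (ball x e))"

definition double_values :: "('a \<Rightarrow> 'b) \<Rightarrow> 'b set" where
  "double_values f = {y. \<exists>x x'. x \<noteq> x' \<and> f x = y \<and> f x' = y}"

lemma Int_image_subset_double_values:
  assumes "U \<inter> U' = {}"
  shows "f ` U \<inter> f ` U' \<subseteq> double_values f"
proof
  fix y assume "y \<in> f ` U \<inter> f ` U'"
  then obtain x x' where "x \<in> U" "x' \<in> U'" "f x = y" "f x' = y" by auto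
  moreover from this assms have "x \<noteq> x'" by auto
  ultimately show "y \<in> double_values f" unfolding double_values_def by auto
qed

lemma locally_inj_at_shrink:
  assumes "locally_inj_at f x" "open U" "x \<in> U"
  obtains e where "e > 0" "ball x e \<subseteq> U" "inj_on f (ball x e)"
proof -
  obtain d where d: "d > 0" "inj_on f (ball x d)"
    using assms unfolding locally_inj_at_def by blast
  obtain e where e: "e > 0" "ball x e \<subseteq> U"
    using assms by (meson openE)
  show ?thesis
    by (rule that[of "min d e"]) (use d e in \<open>auto intro: inj_on_subset\<close>)
qed

text \<open>Within \<open>Y\<close> the image of \<open>B\<close> is open by invariance of domain
  and closed by assumption, so connectedness leaves everything or nothing.\<close>

lemma connected_subset_image_if_locally_inj:
  fixes f :: "'a::euclidean_space \<Rightarrow> 'a"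
  assumes cont: "continuous_on UNIV f" and Y: "connected Y" and B: "closed (f ` B)"
    and loc: "\<And>x. x \<in> B \<Longrightarrow> f x \<in> Y \<Longrightarrow> locally_inj_at f x \<and> x \<in> interior B"
    and meets: "f ` B \<inter> Y \<noteq> {}"
  shows "Y \<subseteq> f ` B"
proof -
  define P where "P = \<Union>{f ` U |U. open U \<and> U \<subseteq> B \<and> inj_on f U}"
  have "open P"
    unfolding P_def
    by (rule open_Union) (auto intro: invariance_of_domain continuous_on_subset[OF cont])
  have sub: "P \<subseteq> f ` B" unfolding P_def by blast
  have inP: "f x \<in> P" if x: "x \<in> B" "f x \<in> Y" for x
  proof -
    obtain e where "e > 0" "ball x e \<subseteq> interior B" "inj_on f (ball x e)"
      using locally_inj_at_shrink[OF _ open_interior] loc[OF x] by metis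
    then have "f ` ball x e \<subseteq> P" "x \<in> ball x e"
      unfolding P_def using interior_subset[of B] by (blast, simp)
    then show ?thesis by blast
  qed
  have "P \<inter> Y = {} \<or> - (f ` B) \<inter> Y = {}"
    by (rule connectedD[OF Y \<open>open P\<close>]) (use B sub inP in auto)
  then show ?thesis
    using meets inP by blast
qed

text \<open>If \<open>y\<close> has a single preimage \<open>x\<close>, values near \<open>y\<close>
  have preimages only near \<open>x\<close>, because the image of the rest is closed; and near
  \<open>x\<close> the map is injective.\<close>

lemma no_double_values_nhd:
  fixes f :: "'a::metric_space \<Rightarrow> 'b::topological_space"
  assumes closed_map: "\<And>K. closed K \<Longrightarrow> closed (f ` K)"
    and y: "y \<notin> double_values f" and loc: "\<And>x. f x = y \<Longrightarrow> locally_inj_at f x"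
  obtains V where "open V" "y \<in> V" "V \<inter> double_values f = {}"
proof (cases "y \<in> range f")
  case False
  show ?thesis
    by (rule that[of "- range f"]) (use False closed_map in \<open>auto simp: double_values_def\<close>)
next
  case True
  then obtain x where x: "f x = y" by auto
  obtain e where e: "e > 0" "inj_on f (ball x e)"
    using loc[OF x] unfolding locally_inj_at_def by auto
  have only: "z = x" if "f z = y" for z
    using y x that unfolding double_values_def by auto
  have cl: "closed (f ` (- ball x e))"
    by (intro closed_map) (simp add: closed_Compl)
  show ?thesis
  proof (rule that[of "- f ` (- ball x e)"])
    show "y \<in> - f ` (- ball x e)"
      using only e by auto
    show "- f ` (- ball x e) \<inter> double_values f = {}"
    proof -
      have "z = z'" if eq: "f z = f z'" "f z \<notin> f ` (- ball x e)" for z z'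
      proof -
        have "z \<in> ball x e" "z' \<in> ball x e" using eq by blast (metis ComplI eq imageI)
        then show ?thesis using e(2) eq(1) by (auto dest: inj_onD)
      qed
      then show ?thesis unfolding double_values_def by (auto simp del: mem_ball)
    qed
  qed (use cl in auto)
qed

text \<open>The exceptional family lies in the target: over a value outside it, every preimage is a
  point of local injectivity. \<open>dense\<close> supplies such points in every open set, also over
  exceptional values.\<close>

locale generic_local_homeo =
  fixes f :: "'a::euclidean_space \<Rightarrow> 'a" and \<T> :: "'a set set"
  assumes cont: "continuous_on UNIV f"
    and closed_map: "closed K \<Longrightarrow> closed (f ` K)"
    and finite_fibre: "finite (f -` {y})"
    and codim2: "codim2_family \<T>"
    and locally_inj: "f x \<notin> \<Union>\<T> \<Longrightarrow> locally_inj_at f x"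
    and dense: "open U \<Longrightarrow> U \<noteq> {} \<Longrightarrow> \<exists>x\<in>U. locally_inj_at f x"
begin

lemmas negligible_\<T> = negligible_codim2[OF codim2]

lemma open_image_ball:
  assumes "inj_on f (ball x e)"
  shows "open (f ` ball x e)"
  using assms cont by (metis invariance_of_domain continuous_on_subset open_ball subset_UNIV)

text \<open>Local injectivity at \<open>x\<close> itself may fail. Over a small ball around
  \<open>f x\<close> that avoids the image of a sphere around \<open>x\<close>, the image of the
  enclosed ball is relatively clopen outside the exceptional set.\<close>

lemma image_ball_generic:
  assumes "r > 0"
  obtains e where "e > 0" "ball (f x) e - \<Union>\<T> \<subseteq> f ` cball x r"
proof -
  \<comment> \<open>The fibre is finite, so a sphere of positive radius below \<open>d\<close>
    contains no preimage of \<open>f x\<close>.\<close>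
  obtain d where d: "d > 0" "\<And>z. f z = f x \<Longrightarrow> z \<noteq> x \<Longrightarrow> d \<le> dist x z"
    using finite_set_avoid[OF finite_fibre[of "f x"], of x] by auto
  define s where "s = min r (d / 2)"
  have s: "s > 0" "s < d" "s \<le> r" using assms d by (auto simp: s_def)
  have "f x \<notin> f ` sphere x s"
  proof
    assume "f x \<in> f ` sphere x s"
    then obtain z where z: "f z = f x" "dist x z = s" by auto
    have "z \<noteq> x" using z s by auto
    from d(2)[OF z(1) this] z s show False by simp
  qed
  moreover have "closed (f ` sphere x s)"
    by (intro closed_map) simp
  ultimately obtain e where e: "e > 0" "ball (f x) e \<subseteq> - f ` sphere x s"
    by (metis ComplI closed_def openE)
  define W where "W = ball (f x) e"
  have "W - \<Union>\<T> \<subseteq> f ` cball x s"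
  proof (rule connected_subset_image_if_locally_inj[OF cont])
    show "connected (W - \<Union>\<T>)"
      unfolding W_def using codim2 by (intro connected_convex_diff_codim2) auto
    show "closed (f ` cball x s)" by (intro closed_map) simp
    show "locally_inj_at f z \<and> z \<in> interior (cball x s)"
      if z: "z \<in> cball x s" "f z \<in> W - \<Union>\<T>" for z
    proof -
      have "z \<notin> sphere x s" using z e unfolding W_def by blast
      then show ?thesis using z locally_inj by auto
    qed
    show "f ` cball x s \<inter> (W - \<Union>\<T>) \<noteq> {}"
    proof -
      \<comment> \<open>A point of local injectivity in \<open>U\<close> yields an open set of
        values in \<open>W\<close>, too large for the negligible exceptional set.\<close>
      define U where "U = ball x s \<inter> f -` W"
      have "open U" "x \<in> U"
        using e s cont unfolding U_def W_def
        by (auto intro!: open_Int open_vimage)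
      then obtain u where u: "u \<in> U" "locally_inj_at f u" using dense by blast
      then obtain \<delta> where \<delta>: "\<delta> > 0" "ball u \<delta> \<subseteq> U" "inj_on f (ball u \<delta>)"
        using locally_inj_at_shrink \<open>open U\<close> by metis
      have "open (f ` ball u \<delta>)" "f ` ball u \<delta> \<noteq> {}"
        using open_image_ball \<delta> by auto
      then obtain w where "w \<in> f ` ball u \<delta>" "w \<notin> \<Union>\<T>"
        using open_meets_complement_negligible negligible_\<T> by metis
      moreover from this obtain v where "v \<in> ball u \<delta>" "w = f v" by (elim imageE)
      ultimately have "v \<in> ball x s" "f v \<in> W - \<Union>\<T>"
        using \<delta>(2) unfolding U_def by (auto simp del: mem_ball)
      moreover have "v \<in> cball x s" using \<open>v \<in> ball x s\<close> by simp
      ultimately show ?thesis by blast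
    qed
  qed
  moreover have "f ` cball x s \<subseteq> f ` cball x r" using s by auto
  ultimately show ?thesis using that[of e] e unfolding W_def by blast
qed

text \<open>Outside the exceptional set, being a double value and not being one are both open
  conditions. This region is connected, and \<open>y\<close> decides which condition holds
  there.\<close>

lemma no_generic_double_values:
  assumes y: "y \<notin> double_values f" and loc: "\<And>x. f x = y \<Longrightarrow> locally_inj_at f x"
  shows "double_values f \<subseteq> \<Union>\<T>"
proof -
  define P where "P = \<Union>{V. open V \<and> V \<inter> double_values f = {}}"
  define Q where "Q = \<Union>{f ` ball x e \<inter> f ` ball x' e |x x' e.
    ball x e \<inter> ball x' e = {} \<and> inj_on f (ball x e) \<and> inj_on f (ball x' e)}"
  have "open P" unfolding P_def by auto
  have "open Q" unfolding Q_def by (rule open_Union) (auto intro!: open_image_ball)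
  have Q: "Q \<subseteq> double_values f"
    unfolding Q_def
  proof (rule Union_least)
    fix V assume "V \<in> {f ` ball x e \<inter> f ` ball x' e |x x' e.
      ball x e \<inter> ball x' e = {} \<and> inj_on f (ball x e) \<and> inj_on f (ball x' e)}"
    then obtain x x' e where "V = f ` ball x e \<inter> f ` ball x' e" "ball x e \<inter> ball x' e = {}"
      by blast
    then show "V \<subseteq> double_values f"
      using Int_image_subset_double_values by metis
  qed
  have P: "P \<inter> double_values f = {}" unfolding P_def by auto
  have inP: "z \<in> P" if z: "z \<notin> double_values f" "\<And>x. f x = z \<Longrightarrow> locally_inj_at f x" for z
  proof -
    obtain V where "open V" "z \<in> V" "V \<inter> double_values f = {}"
      using no_double_values_nhd[of f z] closed_map z by metis
    then show ?thesis unfolding P_def by blast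
  qed
  have inQ: "z \<in> Q" if z: "z \<in> double_values f" "z \<notin> \<Union>\<T>" for z
  proof -
    obtain x x' where x: "x \<noteq> x'" "f x = z" "f x' = z"
      using z unfolding double_values_def by auto
    have "locally_inj_at f x" "locally_inj_at f x'"
      using x z locally_inj by simp_all
    then obtain d d' where d: "d > 0" "inj_on f (ball x d)" and d': "d' > 0" "inj_on f (ball x' d')"
      unfolding locally_inj_at_def by auto
    define e where "e = min (dist x x' / 2) (min d d')"
    have e: "e > 0" "e \<le> d" "e \<le> d'" "e \<le> dist x x' / 2"
      using x d d' by (auto simp: e_def)
    have "ball x e \<inter> ball x' e = {}"
      using e by (intro disjoint_ballI) simp
    moreover have "inj_on f (ball x e)" "inj_on f (ball x' e)"
      using d d' e by (meson inj_on_subset subset_ball)+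
    ultimately have "f ` ball x e \<inter> f ` ball x' e \<subseteq> Q" unfolding Q_def by blast
    moreover have "z \<in> f ` ball x e \<inter> f ` ball x' e"
      using x e by (metis IntI centre_in_ball image_eqI)
    ultimately show ?thesis by blast
  qed
  have conn: "connected (UNIV - \<Union>\<T>)"
    using codim2 by (intro connected_convex_diff_codim2) auto
  have "P \<inter> (UNIV - \<Union>\<T>) = {} \<or> Q \<inter> (UNIV - \<Union>\<T>) = {}"
  proof (rule connectedD[OF conn \<open>open P\<close> \<open>open Q\<close>])
    show "P \<inter> Q \<inter> (UNIV - \<Union>\<T>) = {}" using P Q by blast
    show "UNIV - \<Union>\<T> \<subseteq> P \<union> Q"
    proof
      fix z assume z: "z \<in> UNIV - \<Union>\<T>"
      show "z \<in> P \<union> Q"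
      proof (cases "z \<in> double_values f")
        case True
        then show ?thesis using inQ[of z] z by simp
      next
        case False
        then show ?thesis using inP[OF False] locally_inj z by simp
      qed
    qed
  qed
  \<comment> \<open>\<open>y\<close> itself may be exceptional, but the open set \<open>P\<close>
    containing it also contains nonexceptional values.\<close>
  moreover have "P \<inter> (UNIV - \<Union>\<T>) \<noteq> {}"
    proof -
    have "P \<noteq> {}" using inP[OF y loc] by auto
    then obtain z where "z \<in> P" "z \<notin> \<Union>\<T>"
      using open_meets_complement_negligible[OF \<open>open P\<close> _ negligible_\<T>] by metis
    then show ?thesis by auto
  qed
  ultimately show ?thesis using inQ by blast
qed

text \<open>Disjoint balls around two points with a common image both cover almost all values near
  it, which produces a nonexceptional double value. Once \<open>f\<close> is injective, its range is
  open and closed.\<close>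

lemma bij_if_single_value:
  assumes y: "y \<notin> double_values f" and loc: "\<And>x. f x = y \<Longrightarrow> locally_inj_at f x"
  shows "bij f"
proof -
  have inj: "inj f"
  proof (rule injI, rule ccontr)
    fix x x' assume eq: "f x = f x'" and ne: "x \<noteq> x'"
    define r where "r = dist x x' / 3"
    have r: "r > 0" "r + r < dist x x'" using ne by (auto simp: r_def)
    have disj: "cball x r \<inter> cball x' r = {}"
      using r by (intro disjoint_cballI) simp
    obtain e where e: "e > 0" "ball (f x) e - \<Union>\<T> \<subseteq> f ` cball x r"
      using image_ball_generic r by metis
    obtain e' where e': "e' > 0" "ball (f x') e' - \<Union>\<T> \<subseteq> f ` cball x' r"
      using image_ball_generic r by metis
    have "ball (f x) (min e e') \<noteq> {}" using e e' by simp
    then obtain z where z: "z \<in> ball (f x) (min e e')" "z \<notin> \<Union>\<T>"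
      using open_meets_complement_negligible[OF open_ball _ negligible_\<T>] by metis
    then have "z \<in> f ` cball x r \<inter> f ` cball x' r" using e e' eq by auto
    then have "z \<in> double_values f"
      using subsetD[OF Int_image_subset_double_values[OF disj]] by metis
    then show False using subsetD[OF no_generic_double_values[OF y loc]] z by metis
  qed
  have "open (range f)" "closed (range f)"
    using invariance_of_domain[OF cont _ inj] closed_map by auto
  then have "range f = UNIV"
    using clopen by auto
  with inj show ?thesis by (simp add: bij_def)
qed

end

section \<open>Piecewise affine maps\<close>

lemma affine_image_matrix_affine:
  fixes A :: "real ^ 'n ^ 'm"
  assumes "affine T"
  shows "affine ((\<lambda>x. A *v x + b) ` T)"
  unfolding affine_def
proof (intro ballI allI impI)
  fix y z and u v :: real
  assume y: "y \<in> (\<lambda>x. A *v x + b) ` T" and z: "z \<in> (\<lambda>x. A *v x + b) ` T" and uv: "u + v = 1"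
  obtain x x' where x: "x \<in> T" "y = A *v x + b" and x': "x' \<in> T" "z = A *v x' + b"
    using y z by auto
  have "u *\<^sub>R b + v *\<^sub>R b = b" using uv by (metis scaleR_add_left scaleR_one)
  then have "u *\<^sub>R y + v *\<^sub>R z = A *v (u *\<^sub>R x + v *\<^sub>R x') + b"
    by (simp add: x x' matrix_vector_right_distrib matrix_vector_mult_scaleR scaleR_add_right
        add.assoc add.left_commute)
  moreover have "u *\<^sub>R x + v *\<^sub>R x' \<in> T"
    using assms x x' uv by (intro mem_affine) auto
  ultimately show "u *\<^sub>R y + v *\<^sub>R z \<in> (\<lambda>x. A *v x + b) ` T" by (rule image_eqI)
qed

lemma matrix_affine_image: "(\<lambda>x. A *v x + b) ` T = (+) b ` ((*v) A ` T)"
  by (auto simp: image_image add.commute)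

lemma aff_dim_image_matrix_affine_le:
  fixes A :: "real ^ 'n ^ 'm"
  shows "aff_dim ((\<lambda>x. A *v x + b) ` T) \<le> aff_dim T"
  by (simp add: matrix_affine_image aff_dim_translation_eq aff_dim_linear_image_le)

locale affine_pieces =
  fixes f :: "real ^ 'n \<Rightarrow> real ^ 'n" and I :: "'i set"
    and A :: "'i \<Rightarrow> real ^ 'n ^ 'n" and b :: "'i \<Rightarrow> real ^ 'n" and C :: "'i \<Rightarrow> (real ^ 'n) set"
  assumes finite_I: "finite I"
    and cover: "(\<Union>i\<in>I. C i) = UNIV"
    and polyhedron_C: "i \<in> I \<Longrightarrow> polyhedron (C i)"
    and interior_C: "i \<in> I \<Longrightarrow> interior (C i) \<noteq> {}"
    and disjoint_C: "i \<in> I \<Longrightarrow> j \<in> I \<Longrightarrow> i \<noteq> j \<Longrightarrow> interior (C i) \<inter> interior (C j) = {}"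
    and f_eq: "i \<in> I \<Longrightarrow> x \<in> C i \<Longrightarrow> f x = A i *v x + b i"
begin

lemma piece_cases:
  obtains i where "i \<in> I" "x \<in> C i"
  using cover by blast

lemma closed_C: "i \<in> I \<Longrightarrow> closed (C i)"
  by (simp add: polyhedron_C polyhedron_imp_closed)

lemma closure_interior_C: "i \<in> I \<Longrightarrow> closure (interior (C i)) = C i"
  by (simp add: convex_closure_interior polyhedron_C polyhedron_imp_convex interior_C closed_C)

lemma open_meets_interior:
  assumes "i \<in> I" "x \<in> C i" "open U" "x \<in> U"
  shows "U \<inter> interior (C i) \<noteq> {}"
  using assms closure_interior_C open_Int_closure_eq_empty[of U "interior (C i)"] by blast

lemma continuous_f: "continuous_on UNIV f"
proof -
  have "continuous_on (C i) f" if i: "i \<in> I" for i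
  proof -
    have "continuous_on (C i) (\<lambda>x. A i *v x + b i)" by (intro continuous_intros)
    then show ?thesis using f_eq[OF i] by (simp cong: continuous_on_cong)
  qed
  then show ?thesis
    using continuous_on_closed_Union[of I C f] finite_I closed_C cover by simp
qed

text \<open>The walls are the full hyperplanes bounding the half-spaces that define the cells. A
  connected set missing them cannot cross any such boundary, hence stays in every cell that it
  meets.\<close>

lemma walls:
  obtains \<H> where "finite \<H>" "\<And>H. H \<in> \<H> \<Longrightarrow> \<exists>a \<beta>. a \<noteq> 0 \<and> H = {x. a \<bullet> x = \<beta>}"
    "\<And>i K. i \<in> I \<Longrightarrow> connected K \<Longrightarrow> K \<inter> \<Union>\<H> = {} \<Longrightarrow> K \<inter> C i \<noteq> {} \<Longrightarrow> K \<subseteq> C i"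
proof -
  have "\<forall>i\<in>I. \<exists>F. finite F \<and> C i = \<Inter>F \<and> (\<forall>h\<in>F. \<exists>a \<beta>. a \<noteq> 0 \<and> h = {x. a \<bullet> x \<le> \<beta>})"
    using polyhedron_C unfolding polyhedron_def by blast
  then obtain F where F: "\<And>i. i \<in> I \<Longrightarrow> finite (F i)" "\<And>i. i \<in> I \<Longrightarrow> C i = \<Inter>(F i)"
    "\<And>i h. i \<in> I \<Longrightarrow> h \<in> F i \<Longrightarrow> \<exists>a \<beta>. a \<noteq> 0 \<and> h = {x. a \<bullet> x \<le> \<beta>}"
    by metis
  show ?thesis
  proof (rule that[of "\<Union>i\<in>I. frontier ` F i"])
    show "finite (\<Union>i\<in>I. frontier ` F i)" using finite_I F(1) by simp
    show "\<exists>a \<beta>. a \<noteq> 0 \<and> H = {x. a \<bullet> x = \<beta>}" if H: "H \<in> (\<Union>i\<in>I. frontier ` F i)" for H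
    proof -
      obtain i h where "i \<in> I" "h \<in> F i" "H = frontier h" using H by blast
      then show ?thesis using F(3) frontier_halfspace_le by metis
    qed
    show "K \<subseteq> C i" if i: "i \<in> I" and K: "connected K" "K \<inter> \<Union>(\<Union>i\<in>I. frontier ` F i) = {}" "K \<inter> C i \<noteq> {}"
      for i K
      unfolding F(2)[OF i]
    proof (rule Inter_greatest)
      fix h assume h: "h \<in> F i"
      have "K \<inter> h \<noteq> {}" using K(3) h F(2)[OF i] by blast
      moreover have "K \<inter> frontier h = {}" using K(2) h i by blast
      ultimately show "K \<subseteq> h" using connected_Int_frontier[OF K(1)] by blast
    qed
  qed
qed

section \<open>Local folds along a single wall\<close>

text \<open>Both closed sides contain the hyperplane through \<open>x\<close>. The case
  \<open>i = j\<close> is allowed and covers points in the interior of a cell.\<close>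

definition fold_at :: "real ^ 'n \<Rightarrow> real \<Rightarrow> 'i \<Rightarrow> 'i \<Rightarrow> real ^ 'n \<Rightarrow> bool" where
  "fold_at x e i j a \<longleftrightarrow> e > 0 \<and> i \<in> I \<and> j \<in> I \<and> a \<noteq> 0 \<and>
     (\<forall>z\<in>ball x e. (a \<bullet> (z - x) \<ge> 0 \<longrightarrow> z \<in> C i) \<and> (a \<bullet> (z - x) \<le> 0 \<longrightarrow> z \<in> C j))"

text \<open>The open half-ball is convex and misses every wall, so it lies in one cell; closedness
  of the cell adds the flat side.\<close>

lemma half_ball:
  fixes x a :: "real ^ 'n"
  assumes a: "a \<noteq> 0" and e: "e > 0" and \<H>: "\<And>z. z \<in> ball x e \<Longrightarrow> z \<in> \<Union>\<H> \<Longrightarrow> a \<bullet> (z - x) = 0"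
    and K: "\<And>i K. i \<in> I \<Longrightarrow> connected K \<Longrightarrow> K \<inter> \<Union>\<H> = {} \<Longrightarrow> K \<inter> C i \<noteq> {} \<Longrightarrow> K \<subseteq> C i"
  obtains i where "i \<in> I" "\<And>z. z \<in> ball x e \<Longrightarrow> a \<bullet> (z - x) \<ge> 0 \<Longrightarrow> z \<in> C i"
proof -
  define P where "P = ball x e \<inter> {z. a \<bullet> z > a \<bullet> x}"
  define c where "c = e / (2 * norm a)"
  have c: "c > 0" "c * norm a < e" using a e by (auto simp: c_def)
  have "x + c *\<^sub>R a \<in> P"
    using c a by (simp add: P_def dist_norm inner_add_right)
  moreover obtain i where i: "i \<in> I" "x + c *\<^sub>R a \<in> C i" by (rule piece_cases)
  moreover have "convex P" unfolding P_def by (intro convex_Int convex_ball convex_halfspace_gt)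
  moreover have "P \<inter> \<Union>\<H> = {}"
  proof -
    have "z \<notin> \<Union>\<H>" if "z \<in> P" for z
      using \<H>[of z] that by (auto simp: P_def inner_diff_right simp del: Union_iff)
    then show ?thesis by blast
  qed
  ultimately have PC: "P \<subseteq> C i" using K[OF i(1), of P] convex_connected by blast
  have "z \<in> C i" if z: "z \<in> ball x e" "a \<bullet> (z - x) \<ge> 0" for z
  proof -
    have "z \<in> closure P"
      unfolding closure_approachable
    proof (intro allI impI)
      fix \<epsilon> :: real assume "\<epsilon> > 0"
      \<comment> \<open>The shift along \<open>a\<close> is shorter than \<open>\<epsilon>\<close>
        and than the distance left to the sphere, so it moves \<open>z\<close> into the open
        half-ball.\<close>
      define t where "t = min (\<epsilon> / 2) ((e - dist x z) / 2) / norm a"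
      have "min (\<epsilon> / 2) ((e - dist x z) / 2) > 0" using \<open>\<epsilon> > 0\<close> z by simp
      then have t: "t > 0" "t * norm a < \<epsilon>" "t * norm a < e - dist x z"
        using a by (auto simp: t_def min_less_iff_disj)
      have "dist x (z + t *\<^sub>R a) \<le> dist x z + t * norm a"
        using dist_triangle[of x "z + t *\<^sub>R a" z] t by (simp add: dist_norm)
      moreover have "t * (a \<bullet> a) > 0" using t a by simp
      then have "a \<bullet> (z + t *\<^sub>R a) > a \<bullet> x"
        using z by (simp add: inner_add_right inner_diff_right)
      ultimately have "z + t *\<^sub>R a \<in> P" using t by (simp add: P_def)
      moreover have "dist (z + t *\<^sub>R a) z < \<epsilon>" using t by (simp add: dist_norm)
      ultimately show "\<exists>y\<in>P. dist y z < \<epsilon>" by blast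
    qed
    then show ?thesis using closure_minimal[OF PC closed_C[OF i(1)]] by blast
  qed
  then show ?thesis using that i by blast
qed

text \<open>Away from the pairwise intersections of the walls, at most one wall is met, so that only the
  two pieces on its sides matter.\<close>

lemma fold_structure:
  "\<exists>\<Q>. codim2_family \<Q> \<and> (\<forall>x. x \<notin> \<Union>\<Q> \<longrightarrow> (\<exists>e i j a. fold_at x e i j a))"
proof -
  obtain \<H> where fin: "finite \<H>" and hyp: "\<And>H. H \<in> \<H> \<Longrightarrow> \<exists>a \<beta>. a \<noteq> 0 \<and> H = {x. a \<bullet> x = \<beta>}"
    and K: "\<And>i K. i \<in> I \<Longrightarrow> connected K \<Longrightarrow> K \<inter> \<Union>\<H> = {} \<Longrightarrow> K \<inter> C i \<noteq> {} \<Longrightarrow> K \<subseteq> C i"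
    using walls by metis
  have aff: "affine H" if "H \<in> \<H>" for H using hyp[OF that] affine_hyperplane by metis
  define \<Q> where "\<Q> = {H \<inter> H' |H H'. H \<in> \<H> \<and> H' \<in> \<H> \<and> H \<noteq> H'}"
  have "codim2_family \<Q>"
    unfolding codim2_family_def
  proof (intro conjI ballI)
    have "\<Q> \<subseteq> (\<lambda>(H, H'). H \<inter> H') ` (\<H> \<times> \<H>)" unfolding \<Q>_def by auto
    then show "finite \<Q>" using fin by (meson finite_SigmaI finite_imageI finite_subset)
    show "affine T" if "T \<in> \<Q>" for T
      using that aff unfolding \<Q>_def by (auto intro: affine_Int)
    show "aff_dim T \<le> int DIM(real ^ 'n) - 2" if T: "T \<in> \<Q>" for T
    proof -
      obtain H H' where H: "T = H \<inter> H'" "H \<in> \<H>" "H' \<in> \<H>" "H \<noteq> H'" using T unfolding \<Q>_def by blast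
      obtain a \<beta> where a: "a \<noteq> 0" "H = {x. a \<bullet> x = \<beta>}" using hyp H by blast
      obtain a' \<beta>' where a': "a' \<noteq> 0" "H' = {x. a' \<bullet> x = \<beta>'}" using hyp H by blast
      show ?thesis using codim2_hyperplane_Int a a' H by metis
    qed
  qed
  moreover have "\<exists>e i j a. fold_at x e i j a" if x: "x \<notin> \<Union>\<Q>" for x
  proof -
    \<comment> \<open>A small enough ball meets only walls through \<open>x\<close>, and outside the
      pairwise intersections there is at most one.\<close>
    define \<N> where "\<N> = {H \<in> \<H>. x \<notin> H}"
    have "closed (\<Union>\<N>)" unfolding \<N>_def by (rule closed_Union) (use fin aff affine_closed in auto)
    moreover have "x \<notin> \<Union>\<N>" unfolding \<N>_def by blast
    ultimately obtain e where e: "e > 0" "ball x e \<subseteq> - \<Union>\<N>" by (metis ComplI closed_def openE)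
    obtain a where a: "a \<noteq> 0" "\<And>H z. H \<in> \<H> \<Longrightarrow> x \<in> H \<Longrightarrow> z \<in> H \<Longrightarrow> a \<bullet> (z - x) = 0"
    proof (cases "\<exists>H\<in>\<H>. x \<in> H")
      case True
      then obtain H where H: "H \<in> \<H>" "x \<in> H" by blast
      obtain a \<beta> where a: "a \<noteq> 0" "H = {x. a \<bullet> x = \<beta>}" using hyp H by blast
      have only: "H' = H" if "H' \<in> \<H>" "x \<in> H'" for H'
        using x H that unfolding \<Q>_def by blast
      have "a \<bullet> (z - x) = 0" if "H' \<in> \<H>" "x \<in> H'" "z \<in> H'" for H' z
      proof -
        have "z \<in> H" using only that by blast
        then show ?thesis using a H by (simp add: inner_diff_right)
      qed
      then show ?thesis using that a by blast
    next
      case False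
      \<comment> \<open>No wall meets the ball, so any nonzero normal will do.\<close>
      have "axis undefined 1 \<noteq> (0 :: real ^ 'n)" by (simp add: axis_eq_0_iff)
      then show ?thesis using that False by blast
    qed
    have on_wall: "a \<bullet> (z - x) = 0" if "z \<in> ball x e" "z \<in> \<Union>\<H>" for z
    proof -
      obtain H where "H \<in> \<H>" "z \<in> H" using \<open>z \<in> \<Union>\<H>\<close> by blast
      moreover have "x \<in> H" using e that calculation unfolding \<N>_def by blast
      ultimately show ?thesis using a by blast
    qed
    obtain i where i: "i \<in> I" "\<And>z. z \<in> ball x e \<Longrightarrow> a \<bullet> (z - x) \<ge> 0 \<Longrightarrow> z \<in> C i"
      using half_ball[where a = a and x = x and \<H> = \<H>, OF a(1) e(1) on_wall K] by blast
    have "- a \<noteq> 0" using a by simp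
    moreover have "- a \<bullet> (z - x) = 0" if "z \<in> ball x e" "z \<in> \<Union>\<H>" for z
      using on_wall[OF that] by simp
    ultimately obtain j where j: "j \<in> I" "\<And>z. z \<in> ball x e \<Longrightarrow> - a \<bullet> (z - x) \<ge> 0 \<Longrightarrow> z \<in> C j"
      using half_ball[where a = "- a" and x = x and \<H> = \<H>, OF _ e(1) _ K] by blast
    have "fold_at x e i j a"
      unfolding fold_at_def using e a i j by simp
    then show ?thesis by blast
  qed
  ultimately show ?thesis by blast
qed

text \<open>Points of the hyperplane near \<open>x\<close> lie in both cells, so both affine
  formulas give \<open>f\<close> there; subtracting the values at \<open>x\<close> removes the
  constants.\<close>

lemma fold_agree:
  assumes F: "fold_at x e i j a" and u: "a \<bullet> u = 0"
  shows "A j *v u = A i *v u"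
proof (cases "u = 0")
  case False
  define t where "t = e / (2 * norm u)"
  have e: "e > 0" and ij: "i \<in> I" "j \<in> I" using F by (auto simp: fold_at_def)
  have t: "t > 0" "t * norm u < e" using False e by (auto simp: t_def)
  have "x + t *\<^sub>R u \<in> ball x e" "x \<in> ball x e" using t e by (auto simp: dist_norm)
  then have mem: "x + t *\<^sub>R u \<in> C i \<inter> C j" "x \<in> C i \<inter> C j"
    using F u unfolding fold_at_def by auto
  have "A i *v (x + t *\<^sub>R u) + b i = A j *v (x + t *\<^sub>R u) + b j" "A i *v x + b i = A j *v x + b j"
    using f_eq[OF ij(1)] f_eq[OF ij(2)] mem by (metis IntE)+
  then have "A i *v (x + t *\<^sub>R u) - A i *v x = A j *v (x + t *\<^sub>R u) - A j *v x"
    by (metis add_diff_cancel_right)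
  then have "t *\<^sub>R (A i *v u) = t *\<^sub>R (A j *v u)"
    by (simp add: matrix_vector_right_distrib matrix_vector_mult_scaleR)
  then show ?thesis using t by simp
qed simp

lemma fold_values:
  assumes F: "fold_at x e i j a" and z: "z \<in> ball x e"
  shows "a \<bullet> (z - x) \<ge> 0 \<Longrightarrow> f z = f x + A i *v (z - x)"
    and "a \<bullet> (z - x) \<le> 0 \<Longrightarrow> f z = f x + A j *v (z - x)"
proof -
  have ij: "i \<in> I" "j \<in> I" and "x \<in> ball x e" using F by (auto simp: fold_at_def)
  then have x: "x \<in> C i" "x \<in> C j" using F unfolding fold_at_def by auto
  show "f z = f x + A i *v (z - x)" if "a \<bullet> (z - x) \<ge> 0"
  proof -
    have "z \<in> C i" using F z that unfolding fold_at_def by blast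
    then show ?thesis
      by (simp add: f_eq[OF ij(1)] x matrix_vector_mult_diff_distrib)
  qed
  show "f z = f x + A j *v (z - x)" if "a \<bullet> (z - x) \<le> 0"
  proof -
    have "z \<in> C j" using F z that unfolding fold_at_def by blast
    then show ?thesis
      by (simp add: f_eq[OF ij(2)] x matrix_vector_mult_diff_distrib)
  qed
qed

lemma fold_injective:
  assumes F: "fold_at x e i j a" and det: "det (A i) * det (A j) > 0"
  shows "inj_on f (ball x e)"
proof (rule inj_onI)
  have a: "a \<noteq> 0" using F by (simp add: fold_at_def)
  have nz: "det (A i) \<noteq> 0" "det (A j) \<noteq> 0" using det by auto
  note val = fold_values[OF F]
  have mixed: "z = z'" if "z \<in> ball x e" "z' \<in> ball x e" "a \<bullet> (z - x) \<ge> 0" "a \<bullet> (z' - x) \<le> 0"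
    "f z = f z'" for z z'
  proof -
    have "A i *v (z - x) = A j *v (z' - x)" using val(1)[of z] val(2)[of z'] that by simp
    then have "z - x = z' - x"
      using coherent_fold_injective[OF a fold_agree[OF F] det] that by blast
    then show ?thesis by simp
  qed
  fix z z' assume z: "z \<in> ball x e" "z' \<in> ball x e" and eq: "f z = f z'"
  consider "a \<bullet> (z - x) \<ge> 0" "a \<bullet> (z' - x) \<ge> 0" | "a \<bullet> (z - x) \<ge> 0" "a \<bullet> (z' - x) \<le> 0"
    | "a \<bullet> (z - x) \<le> 0" "a \<bullet> (z' - x) \<ge> 0" | "a \<bullet> (z - x) \<le> 0" "a \<bullet> (z' - x) \<le> 0"
    by linarith
  then show "z = z'"
  proof cases
    case 1
    then have "A i *v (z - x) = A i *v (z' - x)" using val(1) z eq by simp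
    then show ?thesis using det_nonzero_inj[OF nz(1)] by simp
  next
    case 2 then show ?thesis using mixed z eq by blast
  next
    case 3 then show ?thesis using mixed z eq by metis
  next
    case 4
    then have "A j *v (z - x) = A j *v (z' - x)" using val(2) z eq by simp
    then show ?thesis using det_nonzero_inj[OF nz(2)] by simp
  qed
qed

lemma fold_not_injective:
  assumes F: "fold_at x e i j a" and det: "det (A i) * det (A j) < 0"
  shows "\<not> inj f"
proof
  assume inj: "inj f"
  have a: "a \<noteq> 0" and e: "e > 0" using F by (auto simp: fold_at_def)
  obtain p where p: "a \<bullet> p < 0" "\<And>t. A i *v (- t *\<^sub>R p) = A j *v (- t *\<^sub>R a)"
    using incoherent_fold_not_injective[OF a fold_agree[OF F] det] by metis
  \<comment> \<open>The scaled vectors must fit into the ball of radius \<open>e\<close>; the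
    summand 1 makes both length bounds strict.\<close>
  define t where "t = e / (norm p + norm a + 1)"
  have pos: "norm p + norm a + 1 > 0" by (simp add: add_nonneg_pos)
  have t: "t > 0" using e pos by (simp add: t_def)
  have "t * (norm p + norm a + 1) = e" using pos by (simp add: t_def)
  then have "t * norm p + t * norm a + t = e" by (simp add: distrib_left)
  moreover have "t * norm p \<ge> 0" "t * norm a \<ge> 0" using t by simp_all
  ultimately have small: "t * norm p < e" "t * norm a < e" using t by linarith+
  have "x + - t *\<^sub>R p \<in> ball x e" "x + - t *\<^sub>R a \<in> ball x e"
    using small t by (simp_all add: dist_norm)
  moreover have "a \<bullet> (- t *\<^sub>R p) \<ge> 0" "a \<bullet> (- t *\<^sub>R a) \<le> 0"
    using p t by (simp_all add: mult_le_0_iff)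
  ultimately have "f (x + - t *\<^sub>R p) = f (x + - t *\<^sub>R a)"
    using fold_values(1)[OF F, of "x + - t *\<^sub>R p"] fold_values(2)[OF F, of "x + - t *\<^sub>R a"] p(2)[of t]
    by (simp del: scaleR_minus_left)
  then have "x + - t *\<^sub>R p = x + - t *\<^sub>R a" by (rule injD[OF inj])
  then have "p = a" using t by simp
  then show False using p(1) inner_ge_zero[of a] by simp
qed

text \<open>The interior of a cell through \<open>x\<close> reaches into the ball off the
  hyperplane, where every point is interior to \<open>C i\<close> or \<open>C j\<close>. Hence cells
  of opposite sign sharing a generic point are the two sides of a fold.\<close>

lemma fold_pieces:
  assumes F: "fold_at x e i j a" and k: "k \<in> I" "x \<in> C k"
  shows "k = i \<or> k = j"
proof -
  have a: "a \<noteq> 0" and e: "e > 0" and ij: "i \<in> I" "j \<in> I" using F by (auto simp: fold_at_def)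
  have "ball x e \<inter> interior (C k) \<noteq> {}"
    using open_meets_interior[OF k] e by simp
  moreover have "negligible {z. a \<bullet> z = a \<bullet> x}" using a negligible_hyperplane by blast
  ultimately obtain z where z: "z \<in> ball x e" "z \<in> interior (C k)" "a \<bullet> z \<noteq> a \<bullet> x"
    using open_meets_complement_negligible[of "ball x e \<inter> interior (C k)"] by blast
  have "ball x e \<inter> {z. a \<bullet> z > a \<bullet> x} \<subseteq> interior (C i)"
    using F unfolding fold_at_def
    by (intro interior_maximal open_Int open_ball open_halfspace_gt) (auto simp: inner_diff_right)
  moreover have "ball x e \<inter> {z. a \<bullet> z < a \<bullet> x} \<subseteq> interior (C j)"
    using F unfolding fold_at_def
    by (intro interior_maximal open_Int open_ball open_halfspace_lt) (auto simp: inner_diff_right)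
  ultimately have "z \<in> interior (C i) \<or> z \<in> interior (C j)" using z by force
  then show ?thesis using disjoint_C[OF k(1)] ij z by blast
qed

section \<open>Injectivity forces determinants of one sign\<close>

lemma det_nonzero_if_inj:
  assumes "inj f" and i: "i \<in> I"
  shows "det (A i) \<noteq> 0"
proof
  assume "det (A i) = 0"
  then have "\<not> invertible (A i)" by (simp add: invertible_det_nz)
  then obtain u where u: "A i *v u = 0" "u \<noteq> 0"
    by (metis invertible_left_inverse matrix_left_invertible_ker)
  obtain x where "x \<in> interior (C i)" using interior_C[OF i] by blast
  then obtain e where e: "e > 0" "ball x e \<subseteq> C i" by (meson mem_interior)
  \<comment> \<open>A short multiple of the kernel vector stays in the cell, and \<open>f\<close>
    does not change along it.\<close>
  define t where "t = e / (2 * norm u)"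
  have t: "t > 0" "t * norm u < e" using e u by (auto simp: t_def)
  have "x + t *\<^sub>R u \<in> ball x e" "x \<in> ball x e" using t e by (auto simp: dist_norm)
  then have "x + t *\<^sub>R u \<in> C i" "x \<in> C i" using e by blast+
  then have "f (x + t *\<^sub>R u) = f x"
    using f_eq[OF i] u by (simp add: matrix_vector_right_distrib matrix_vector_mult_scaleR)
  then have "x + t *\<^sub>R u = x" by (rule injD[OF \<open>inj f\<close>])
  then show False using t u by simp
qed

text \<open>The cells of positive and of negative determinant form two closed sets covering the
  space. A generic common point would be a fold with opposite signs, so connectedness of the generic
  set excludes one sign.\<close>

lemma coherent_if_inj:
  assumes inj: "inj f"
  shows "(\<forall>i\<in>I. det (A i) > 0) \<or> (\<forall>i\<in>I. det (A i) < 0)"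
proof -
  obtain \<Q> where Q: "codim2_family \<Q>" and fold: "\<forall>x. x \<notin> \<Union>\<Q> \<longrightarrow> (\<exists>e i j a. fold_at x e i j a)"
    using fold_structure by blast
  define P where "P = (\<Union>i\<in>{i\<in>I. det (A i) > 0}. C i)"
  define M where "M = (\<Union>i\<in>{i\<in>I. det (A i) < 0}. C i)"
  have conn: "connected (UNIV - \<Union>\<Q>)"
    using Q by (intro connected_convex_diff_codim2) auto
  have "P \<inter> (UNIV - \<Union>\<Q>) = {} \<or> M \<inter> (UNIV - \<Union>\<Q>) = {}"
  proof (rule connected_closedD[OF conn])
    show "closed P" "closed M"
      unfolding P_def M_def using finite_I closed_C by auto
    show "UNIV - \<Union>\<Q> \<subseteq> P \<union> M"
    proof
      fix x
      obtain i where "i \<in> I" "x \<in> C i" by (rule piece_cases)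
      then show "x \<in> P \<union> M"
        using det_nonzero_if_inj[OF inj] unfolding P_def M_def by (cases "det (A i) > 0") force+
    qed
    show "P \<inter> M \<inter> (UNIV - \<Union>\<Q>) = {}"
    proof (rule ccontr)
      assume "P \<inter> M \<inter> (UNIV - \<Union>\<Q>) \<noteq> {}"
      then obtain x k l where x: "x \<notin> \<Union>\<Q>" and k: "k \<in> I" "x \<in> C k" "det (A k) > 0"
        and l: "l \<in> I" "x \<in> C l" "det (A l) < 0"
        unfolding P_def M_def by auto
      obtain e i j a where F: "fold_at x e i j a" using fold x by blast
      have "k \<in> {i, j}" "l \<in> {i, j}" using fold_pieces[OF F] k l by auto
      then have "det (A i) * det (A j) < 0"
        using k l by (auto simp: mult_less_0_iff)
      then show False using fold_not_injective[OF F] inj by blast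
    qed
  qed
  \<comment> \<open>Every cell contains generic points, so a sign class missing the generic set has
    no cells.\<close>
  moreover have generic: "\<exists>x\<in>C i. x \<notin> \<Union>\<Q>" if i: "i \<in> I" for i
  proof -
    obtain x where "x \<in> interior (C i)" "x \<notin> \<Union>\<Q>"
      using open_meets_complement_negligible[OF open_interior interior_C[OF i] negligible_codim2[OF Q]]
      by metis
    then show ?thesis using interior_subset by blast
  qed
  ultimately have "\<not> (\<exists>i\<in>I. det (A i) > 0) \<or> \<not> (\<exists>i\<in>I. det (A i) < 0)"
    unfolding P_def M_def by blast
  then show ?thesis using det_nonzero_if_inj[OF inj] by (metis linorder_neqE_linordered_idom)
qed

section \<open>Regular values and the converse\<close>

text \<open>Boundaries of convex sets are negligible and affine maps keep them so; this gives the
  existence of regular values.\<close>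

lemma negligible_image_frontiers: "negligible (\<Union>i\<in>I. f ` frontier (C i))"
proof (rule negligible_Union)
  show "negligible S" if S: "S \<in> (\<lambda>i. f ` frontier (C i)) ` I" for S
  proof -
    obtain i where i: "i \<in> I" "S = f ` frontier (C i)" using S by blast
    have "frontier (C i) \<subseteq> C i" using closed_C[OF i(1)] by (simp add: frontier_subset_eq)
    then have "S = (\<lambda>x. A i *v x + b i) ` frontier (C i)"
      using f_eq[OF i(1)] i(2) by (intro image_cong[OF refl, THEN trans[OF i(2)]]) blast
    moreover have "negligible (frontier (C i))"
      by (simp add: negligible_convex_frontier polyhedron_imp_convex polyhedron_C i)
    moreover have "(\<lambda>x. A i *v x + b i) differentiable_on frontier (C i)"
      by (intro differentiable_on_add linear_imp_differentiable_on differentiable_on_const) auto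
    ultimately show ?thesis
      by (simp add: negligible_differentiable_image_negligible)
  qed
qed (use finite_I in simp)

text \<open>Equal signs make every fold injective, which is local injectivity off the wall
  intersections. Regularity of \<open>y\<close> puts its only preimage in the interior of a
  cell.\<close>

lemma bij_if_coherent:
  assumes det: "(\<forall>i\<in>I. det (A i) > 0) \<or> (\<forall>i\<in>I. det (A i) < 0)"
    and y: "y \<notin> (\<Union>i\<in>I. f ` frontier (C i))" and single: "card (f -` {y}) = 1"
  shows "bij f"
proof -
  have det_prod: "det (A i) * det (A j) > 0" if "i \<in> I" "j \<in> I" for i j
    using det that by (auto simp: zero_less_mult_iff)
  then have nz: "det (A i) \<noteq> 0" if "i \<in> I" for i using that by fastforce
  have inj_C: "inj_on f (C i)" if i: "i \<in> I" for i
    using f_eq[OF i] det_nonzero_inj[OF nz[OF i]] by (intro inj_onI) simp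
  have interior_inj: "locally_inj_at f x" if x: "i \<in> I" "x \<in> interior (C i)" for i x
    using x inj_C[OF x(1)] unfolding locally_inj_at_def by (meson inj_on_subset mem_interior)
  obtain \<Q> where Q: "codim2_family \<Q>" and fold: "\<forall>x. x \<notin> \<Union>\<Q> \<longrightarrow> (\<exists>e i j a. fold_at x e i j a)"
    using fold_structure by blast
  \<comment> \<open>The wall intersections are mapped by every affine piece rather than by
    \<open>f\<close>, so that the images are affine. Whichever cell contains \<open>x\<close>, a
    value \<open>f x\<close> outside these images keeps \<open>x\<close> off the wall
    intersections.\<close>
  define \<T> where "\<T> = (\<Union>i\<in>I. (\<lambda>T. (\<lambda>x. A i *v x + b i) ` T) ` \<Q>)"
  interpret generic_local_homeo f \<T>
  proof
    show "continuous_on UNIV f" by (rule continuous_f)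
    show "closed (f ` K)" if K: "closed K" for K
    proof -
      have "closed (f ` (K \<inter> C i))" if i: "i \<in> I" for i
      proof -
        have "f ` (K \<inter> C i) = (\<lambda>x. A i *v x + b i) ` (K \<inter> C i)"
          using f_eq[OF i] by (intro image_cong) auto
        moreover have "closed ((*v) (A i) ` (K \<inter> C i))"
          using K closed_C[OF i] det_nonzero_inj[OF nz[OF i]]
          by (intro closed_injective_linear_image) (auto intro: injI)
        ultimately show ?thesis by (simp add: matrix_affine_image closed_translation)
      qed
      moreover have "f ` K = (\<Union>i\<in>I. f ` (K \<inter> C i))" using cover by blast
      ultimately show ?thesis using finite_I by (simp add: closed_UN)
    qed
    show "finite (f -` {z})" for z
    proof -
      have "finite (f -` {z} \<inter> C i)" if "i \<in> I" for i
        using finite_vimage_IntI[OF _ inj_C[OF that], of "{z}"] by simp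
      moreover have "f -` {z} = (\<Union>i\<in>I. f -` {z} \<inter> C i)" using cover by blast
      ultimately show ?thesis using finite_I by (metis finite_UN)
    qed
    show "codim2_family \<T>"
      unfolding codim2_family_def
    proof (intro conjI ballI)
      show "finite \<T>" using Q finite_I unfolding \<T>_def codim2_family_def by simp
      fix S assume "S \<in> \<T>"
      then obtain i T where S: "S = (\<lambda>x. A i *v x + b i) ` T" and T: "T \<in> \<Q>"
        unfolding \<T>_def by blast
      then show "affine S" using Q affine_image_matrix_affine unfolding codim2_family_def by blast
      have "aff_dim S \<le> aff_dim T" unfolding S by (rule aff_dim_image_matrix_affine_le)
      also have "\<dots> \<le> int DIM(real ^ 'n) - 2" using Q T unfolding codim2_family_def by blast
      finally show "aff_dim S \<le> int DIM(real ^ 'n) - 2" .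
    qed
    show "locally_inj_at f x" if x: "f x \<notin> \<Union>\<T>" for x
    proof -
      obtain i where i: "i \<in> I" "x \<in> C i" by (rule piece_cases)
      have "x \<notin> \<Union>\<Q>" using x f_eq[OF i] i(1) unfolding \<T>_def by blast
      then obtain e i j a where F: "fold_at x e i j a" using fold by blast
      then have "e > 0" "i \<in> I" "j \<in> I" by (auto simp: fold_at_def)
      then show ?thesis
        unfolding locally_inj_at_def using fold_injective[OF F] det_prod by blast
    qed
    show "\<exists>x\<in>U. locally_inj_at f x" if U: "open U" "U \<noteq> {}" for U
    proof -
      obtain x where x: "x \<in> U" using U by blast
      obtain i where i: "i \<in> I" "x \<in> C i" by (rule piece_cases)
      show ?thesis using open_meets_interior[OF i U(1) x] interior_inj[OF i(1)] by blast
    qed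
  qed
  obtain x0 where x0: "f -` {y} = {x0}" using single by (meson card_1_singletonE)
  show ?thesis
  proof (rule bij_if_single_value)
    have "x = x0" if "f x = y" for x using x0 that by blast
    then show "y \<notin> double_values f" unfolding double_values_def by auto
    show "locally_inj_at f x" if "f x = y" for x
    proof -
      obtain i where i: "i \<in> I" "x \<in> C i" by (rule piece_cases)
      have "x \<notin> frontier (C i)" using y i(1) that by blast
      then have "x \<in> interior (C i)" using i closure_subset[of "C i"] by (auto simp: frontier_def)
      then show ?thesis using interior_inj i by blast
    qed
  qed
qed

end

lemma jacobian_matrix_affine:
  "jacobian (\<lambda>x. A *v x + b) (at x) = (A :: real ^ 'n ^ 'm)"
proof -
  have "((\<lambda>x. A *v x + b) has_derivative (\<lambda>h. A *v h)) (at x)"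
    by (auto intro!: derivative_eq_intros bounded_linear_imp_has_derivative linear_linear[THEN iffD2])
  then show ?thesis
    unfolding jacobian_def by (simp add: frechet_derivative_at[symmetric] matrix_of_matrix_vector_mul)
qed

theorem theorem4:
  fixes f :: "real ^ 'n \<Rightarrow> real ^ 'n"
    and N :: nat
    and g :: "nat \<Rightarrow> real ^ 'n \<Rightarrow> real ^ 'n"
    and C :: "nat \<Rightarrow> (real ^ 'n) set"
  assumes "tropical_rational_map f"
    and "linear_pieces f N g C"
  shows "tropical_isomorphism f \<longleftrightarrow>
     ((\<forall>i\<in>{1..N}. \<forall>x. det (jacobian (g i) (at x)) > 0) \<or>
      (\<forall>i\<in>{1..N}. \<forall>x. det (jacobian (g i) (at x)) < 0)) \<and>
     (\<exists>y0. regular_value f N C y0 \<and> card (f -` {y0}) = 1)"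
proof -
  have "\<forall>i\<in>{1..N}. \<exists>A b. g i = (\<lambda>x. A *v x + b)"
    using assms(2) unfolding linear_pieces_def linear_map_def by blast
  then obtain A b where g: "\<And>i. i \<in> {1..N} \<Longrightarrow> g i = (\<lambda>x. A i *v x + b i)"
    by metis
  interpret affine_pieces f "{1..N}" A b C
  proof
    fix i assume i: "i \<in> {1..N}"
    then have "polyhedron (C i)" "aff_dim (C i) = int CARD('n)"
      using assms(2) unfolding linear_pieces_def by blast+
    \<comment> \<open>In full affine dimension the interior is the relative interior, which is
      nonempty for a nonempty convex set.\<close>
    then show "polyhedron (C i)" "interior (C i) \<noteq> {}"
      by (auto simp: interior_rel_interior_gen rel_interior_eq_empty polyhedron_imp_convex)
    show "f x = A i *v x + b i" if "x \<in> C i" for x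
      using assms(2) i that g[OF i] unfolding linear_pieces_def by auto
  qed (use assms(2) in \<open>auto simp: linear_pieces_def\<close>)
  have jac: "det (jacobian (g i) (at x)) = det (A i)" if "i \<in> {1..N}" for i x
    by (simp add: g[OF that] jacobian_matrix_affine)
  have reg: "regular_value f N C y \<longleftrightarrow> y \<notin> (\<Union>i\<in>{1..N}. f ` frontier (C i))" for y
    by (simp add: regular_value_def)
  have "bij f \<longleftrightarrow> ((\<forall>i\<in>{1..N}. det (A i) > 0) \<or> (\<forall>i\<in>{1..N}. det (A i) < 0)) \<and>
     (\<exists>y0. regular_value f N C y0 \<and> card (f -` {y0}) = 1)" (is "_ \<longleftrightarrow> ?coherent \<and> ?single")
  proof
    assume bij: "bij f"
    \<comment> \<open>The images of the boundaries are negligible, so some value avoids them all;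
      bijectivity gives it exactly one preimage.\<close>
    obtain y where y: "regular_value f N C y"
      unfolding reg using open_meets_complement_negligible[OF open_UNIV _ negligible_image_frontiers]
      by auto
    have "card (f -` {y}) = 1"
      using bij_vimage_eq_inv_image[OF bij, of "{y}"] by simp
    then show "?coherent \<and> ?single"
      using coherent_if_inj bij_is_inj[OF bij] y by blast
  next
    assume "?coherent \<and> ?single"
    then show "bij f" using bij_if_coherent unfolding reg by blast
  qed
  then show ?thesis
    using assms(1) jac by (simp add: tropical_isomorphism_def)
qed

end
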